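(* The following lower bounds hold: $\mathbf m(5)\ge 32$, $\mathbf m(6)\ge 64$, $\mathbf m(7)\ge 128$, $\mathbf m(8)\ge 263$, and $\mathbf m(9)\ge 538$.
   Context: An $n$-uniform hypergraph $H=(V,E)$ consists of a finite vertex set $V$ and an edge set $E\subseteq\{A\subseteq V: |A|=n\}$. $H$ has property B if it is 2-colorable, i.e., if its vertices can be colored with two colors (red and blue) in such a way that no edge is monochromatic. For a positive integer $n$, $\mathbf m(n)$ denotes the smallest number of edges $|E|$ of an $n$-uniform hypergraph that does not have property B. *)

theory Defs
  imports Main
begin

definition uniform_hypergraph :: "nat \<Rightarrow> 'a set \<Rightarrow> 'a set set \<Rightarrow> bool" where
  "uniform_hypergraph n V E \<longleftrightarrow> finite V \<and> E \<subseteq> {A. A \<subseteq> V \<and> card A = n}"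

datatype colour = Red | Blue

definition monochromatic :: "('a \<Rightarrow> colour) \<Rightarrow> 'a set \<Rightarrow> bool" where
  "monochromatic c A \<longleftrightarrow> (\<exists>k. \<forall>v\<in>A. c v = k)"

(* Colours of elements outside the vertex set are irrelevant, since edges are subsets of it;
   hence total colourings, and no vertex set argument. *)
definition property_B :: "'a set set \<Rightarrow> bool" where
  "property_B E \<longleftrightarrow> (\<exists>c. \<forall>A\<in>E. \<not> monochromatic c A)"

(* Vertices are natural numbers: every finite hypergraph has an isomorphic copy there, so the
   minimum is the same as over arbitrary vertex types (least_edges_le below). For n > 0 the
   minimum is over a nonempty set (ex_not_property_B below). *)
definition least_edges :: "nat \<Rightarrow> nat" ("\<^bold>m") where
  "\<^bold>m n = (LEAST k. \<exists>(V :: nat set) E. uniform_hypergraph n V E \<and> \<not> property_B E \<and> card E = k)"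

lemma ex_not_property_B:
  assumes "n > 0"
  shows "\<exists>(V :: nat set) E. uniform_hypergraph n V E \<and> \<not> property_B E"
proof (intro exI conjI)
  let ?V = "{..<2 * n - 1}"
  let ?E = "{A. A \<subseteq> ?V \<and> card A = n}"
  show "uniform_hypergraph n ?V ?E"
    by (auto simp: uniform_hypergraph_def)
  show "\<not> property_B ?E"
    unfolding property_B_def
  proof (rule notI, elim exE)
    fix c assume c: "\<forall>A\<in>?E. \<not> monochromatic c A"
    have small: "card {v\<in>?V. c v = k} < n" for k
    proof (rule ccontr)
      assume "\<not> card {v\<in>?V. c v = k} < n"
      then obtain A where "A \<subseteq> {v\<in>?V. c v = k}" "card A = n"
        by (meson not_less obtain_subset_with_card_n)
      then have "A \<in> ?E" "monochromatic c A"
        unfolding monochromatic_def by blast+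
      with c show False by blast
    qed
    have "?V = {v\<in>?V. c v = Red} \<union> {v\<in>?V. c v = Blue}"
      using colour.exhaust by auto
    then have "card ?V \<le> card {v\<in>?V. c v = Red} + card {v\<in>?V. c v = Blue}"
      by (metis (lifting) card_Un_le)
    with small[of Red] small[of Blue] assms show False by simp
  qed
qed

lemma least_edges_le:
  fixes V :: "'a set"
  assumes H: "uniform_hypergraph n V E" and nB: "\<not> property_B E"
  shows "\<^bold>m n \<le> card E"
proof -
  from H have fin: "finite V" and sub: "\<And>A. A \<in> E \<Longrightarrow> A \<subseteq> V \<and> card A = n"
    by (auto simp: uniform_hypergraph_def)
  from finite_imp_inj_to_nat_seg[OF fin] obtain f :: "'a \<Rightarrow> nat" where f: "inj_on f V"
    by blast
  let ?E = "(`) f ` E"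
  have "uniform_hypergraph n (f ` V) ?E"
    using fin sub f by (auto simp: uniform_hypergraph_def card_image inj_on_subset)
  moreover have "\<not> property_B ?E"
  proof
    assume "property_B ?E"
    then obtain c where "\<forall>A\<in>?E. \<not> monochromatic c A"
      by (auto simp: property_B_def)
    then have "\<forall>A\<in>E. \<not> monochromatic (c \<circ> f) A"
      by (auto simp: monochromatic_def)
    with nB show False by (auto simp: property_B_def)
  qed
  moreover have "card ?E = card E"
  proof (rule card_image)
    show "inj_on ((`) f) E"
      using f sub by (meson inj_onI inj_on_image_eq_iff)
  qed
  ultimately show ?thesis
    unfolding least_edges_def by (intro Least_le) blast
qed

end

theory Submission
  imports Defs "HOL-Library.FuncSet"
begin

text \<open>
  A non-2-colourable hypergraph with few edges is chosen with as few vertices as possible. Two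
  vertices in no common edge could be identified, so any two vertices share an edge; this bounds
  the number of vertices in terms of the number of edges and bounds every degree from below.

  Colour the vertices greedily along a linear order, blue unless that completes a blue edge
  (Pluhar, Cherkashin-Kozik). As the colouring fails, there is an edge inside the initial segment
  of length L, an edge inside the final segment from position S on, or a pair of edges
  A, B with A \<inter> B = {u}, where u lies in between, is the last vertex of A and the first of B.
  Counting these configurations over all orders forces many pairs of edges with exactly one common
  vertex, and counting over the orders that start at a given vertex bounds its degree from above.
  On the other hand, degrees confined to a short interval bound the sum of the squared degrees, and
  hence the number of such pairs, from above. For suitable cut-offs L, S the bounds contradict each
  other; isolated vertices may be added freely, so that one computation serves a whole range of
  vertex numbers.
\<close>

section \<open>Counting bijections with constraints\<close>

text \<open>The falling factorial x (x-1) ... (x-k+1), which counts the injections of a k-set into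
  an x-set. Truncated subtraction makes it 0 for k > x, as that count demands.\<close>

primrec falling :: "nat \<Rightarrow> nat \<Rightarrow> nat" where
  "falling x 0 = 1"
| "falling x (Suc k) = x * falling (x - 1) k"

lemma fact_eq_falling: "k \<le> x \<Longrightarrow> fact x = falling x k * fact (x - k)"
proof (induction k arbitrary: x)
  case (Suc k)
  then obtain y where "x = Suc y" by (cases x) auto
  with Suc show ?case by (simp add: algebra_simps)
qed simp

text \<open>Extensional functions are used so that each bijection is a single element and the whole
  set is finite.\<close>

definition bijections :: "'a set \<Rightarrow> 'b set \<Rightarrow> ('a \<Rightarrow> 'b) set" where
  "bijections V W = {f \<in> V \<rightarrow>\<^sub>E W. bij_betw f V W}"

definition obeys :: "('a set \<times> 'b set) list \<Rightarrow> ('a \<Rightarrow> 'b) \<Rightarrow> bool" where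
  "obeys cs f \<longleftrightarrow> (\<forall>(A, X)\<in>set cs. f ` A \<subseteq> X)"

text \<open>The sets A are pairwise disjoint subsets of V, and the sets X pairwise disjoint subsets of W.\<close>

fun separated :: "('a set \<times> 'b set) list \<Rightarrow> 'a set \<Rightarrow> 'b set \<Rightarrow> bool" where
  "separated [] V W \<longleftrightarrow> True"
| "separated ((A, X) # cs) V W \<longleftrightarrow> A \<subseteq> V \<and> X \<subseteq> W \<and> separated cs (V - A) (W - X)"

lemma obeys_simps [simp]:
  "obeys [] f"
  "obeys ((A, X) # cs) f \<longleftrightarrow> f ` A \<subseteq> X \<and> obeys cs f"
  by (auto simp: obeys_def)

lemma separated_mono:
  "separated cs V W \<Longrightarrow> V \<subseteq> V' \<Longrightarrow> W \<subseteq> W' \<Longrightarrow> separated cs V' W'"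
proof (induction cs V W arbitrary: V' W' rule: separated.induct)
  case (2 A X cs V W)
  from 2(2-4) show ?case by (auto intro!: 2(1)[of "V' - A" "W' - X"])
qed simp

lemma obeys_cong:
  "separated cs V W \<Longrightarrow> (\<And>z. z \<in> V \<Longrightarrow> f z = g z) \<Longrightarrow> obeys cs f \<longleftrightarrow> obeys cs g"
proof (induction cs V W rule: separated.induct)
  case (2 A X cs V W)
  have "f ` A = g ` A" using 2(2,3) by (intro image_cong) auto
  moreover have "obeys cs f \<longleftrightarrow> obeys cs g" using 2 by auto
  ultimately show ?case by simp
qed simp

lemma finite_bijections [simp]: "finite V \<Longrightarrow> finite W \<Longrightarrow> finite (bijections V W)"
  unfolding bijections_def by (intro finite_subset[OF _ finite_PiE[of V "\<lambda>_. W"]]) auto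

text \<open>Once the value at x is prescribed, restriction and function update are inverse to each
  other.\<close>

lemma bij_betw_bijections_remove:
  assumes x: "x \<in> V" and y: "y \<in> W"
  shows "bij_betw (\<lambda>f. restrict f (V - {x})) {f \<in> bijections V W. f x = y} (bijections (V - {x}) (W - {y}))"
proof (rule bij_betwI[where g = "\<lambda>g. g(x := y)"])
  show "(\<lambda>f. restrict f (V - {x})) \<in> {f \<in> bijections V W. f x = y} \<rightarrow> bijections (V - {x}) (W - {y})"
  proof (intro funcsetI)
    fix f assume "f \<in> {f \<in> bijections V W. f x = y}"
    then have f: "bij_betw f V W" "f x = y" by (auto simp: bijections_def)
    then have "bij_betw f (V - {x}) (W - {y})" using x by (metis bij_betw_DiffI bij_betw_singletonI empty_subsetI insert_subset y)
    then have "bij_betw (restrict f (V - {x})) (V - {x}) (W - {y})"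
      by (subst bij_betw_cong[where g = f]) auto
    then show "restrict f (V - {x}) \<in> bijections (V - {x}) (W - {y})"
      unfolding bijections_def by (auto dest: bij_betwE)
  qed
next
  show "(\<lambda>g. g(x := y)) \<in> bijections (V - {x}) (W - {y}) \<rightarrow> {f \<in> bijections V W. f x = y}"
  proof (intro funcsetI)
    fix g assume g: "g \<in> bijections (V - {x}) (W - {y})"
    then have "bij_betw g (V - {x}) (W - {y})" by (auto simp: bijections_def)
    then have "bij_betw (g(x := y)) (V - {x}) (W - {y})"
      by (subst bij_betw_cong[where g = g]) auto
    then have "bij_betw (g(x := y)) ((V - {x}) \<union> {x}) ((W - {y}) \<union> {y})"
      by (intro bij_betw_combine) auto
    then have "bij_betw (g(x := y)) V W" using x y by (simp add: insert_absorb)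
    moreover have "g(x := y) \<in> extensional V"
      using g x by (auto simp: bijections_def PiE_def extensional_def)
    ultimately show "g(x := y) \<in> {f \<in> bijections V W. f x = y}"
      by (auto simp: bijections_def PiE_def dest: bij_betwE)
  qed
next
  fix f assume "f \<in> {f \<in> bijections V W. f x = y}"
  then show "(restrict f (V - {x}))(x := y) = f"
    using x by (auto simp: bijections_def PiE_def extensional_def fun_eq_iff)
next
  fix g assume "g \<in> bijections (V - {x}) (W - {y})"
  then show "restrict (g(x := y)) (V - {x}) = g"
    by (auto simp: bijections_def PiE_def extensional_def fun_eq_iff)
qed

text \<open>Split by the image y of x. By injectivity the rest of A must avoid y, which turns X into
  X - {y}; the other constraints do not mention x.\<close>

lemma card_bijections_insert_constraint:
  assumes fin: "finite V" "finite W" and x: "x \<notin> A" and sep: "separated ((insert x A, X) # cs) V W"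
  shows "card {f \<in> bijections V W. obeys ((insert x A, X) # cs) f} =
    (\<Sum>y\<in>X. card {f \<in> bijections (V - {x}) (W - {y}). obeys ((A, X - {y}) # cs) f})"
proof -
  let ?S = "\<lambda>y. {f \<in> bijections V W. f x = y \<and> obeys ((insert x A, X) # cs) f}"
  let ?T = "\<lambda>y. {f \<in> bijections (V - {x}) (W - {y}). obeys ((A, X - {y}) # cs) f}"
  have finX: "finite X" using sep fin by (auto intro: finite_subset)
  have "{f \<in> bijections V W. obeys ((insert x A, X) # cs) f} = (\<Union>y\<in>X. ?S y)" by auto
  moreover have "card (\<Union>y\<in>X. ?S y) = (\<Sum>y\<in>X. card (?S y))"
    using fin finX by (intro card_UN_disjoint) auto
  moreover have "card (?S y) = card (?T y)" if y: "y \<in> X" for y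
  proof -
    have xV: "x \<in> V" and yW: "y \<in> W" using sep y by auto
    let ?r = "\<lambda>f. restrict f (V - {x})"
    note b = bij_betw_bijections_remove[OF xV yW]
    have iff: "obeys ((insert x A, X) # cs) f \<longleftrightarrow> obeys ((A, X - {y}) # cs) (?r f)"
      if f: "f \<in> bijections V W" "f x = y" for f
    proof -
      have A: "A \<subseteq> V - {x}" and c: "separated cs (V - insert x A) (W - X)" using sep x by auto
      have inj: "inj_on f V" using f by (auto simp: bijections_def bij_betw_def)
      have "?r f ` A = f ` A" using A by (intro image_cong) auto
      moreover have "y \<notin> f ` A"
        using inj A xV f(2) by (auto simp: inj_on_def)
      moreover have "obeys cs f \<longleftrightarrow> obeys cs (?r f)"
        by (rule obeys_cong[OF c]) auto
      ultimately show ?thesis using f(2) y by (simp add: subset_Diff_insert)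
    qed
    have S: "?S y = {f \<in> {f \<in> bijections V W. f x = y}. obeys ((A, X - {y}) # cs) (?r f)}"
      using iff by blast
    have im: "?r ` ?S y = ?T y"
      unfolding S bij_betw_imp_surj_on[OF b, symmetric] by blast
    have inj: "inj_on ?r (?S y)"
      using bij_betw_imp_inj_on[OF b] by (rule inj_on_subset) auto
    show ?thesis by (subst im[symmetric], rule card_image[OF inj, symmetric])
  qed
  ultimately show ?thesis by simp
qed


text \<open>Each block A goes injectively into its target X, independently of the other blocks
  because the targets are disjoint; the remaining elements of V then fill the remaining places
  arbitrarily. The outer induction is on the constraints, the inner one on the first block.\<close>

lemma card_bijections:
  assumes "finite V" "finite W" "card V = card W" "separated cs V W"
  shows "card {f \<in> bijections V W. obeys cs f} =
    (\<Prod>(A, X)\<leftarrow>cs. falling (card X) (card A)) * fact (card V - (\<Sum>(A, X)\<leftarrow>cs. card A))"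
  using assms
proof (induction cs arbitrary: V W)
  case Nil
  have "card (bijections V W) = fact (card V)"
    using Nil(1-3)
  proof (induction V arbitrary: W rule: finite_induct)
    case empty
    then have "bijections {} W = {\<lambda>_. undefined}" by (auto simp: bijections_def bij_betw_def)
    then show ?case by (metis card_1_singleton_iff card.empty fact_0 One_nat_def)
  next
    case (insert x V)
    have fW: "card W = Suc (card V)" using insert by simp
    have "bijections (insert x V) W = (\<Union>y\<in>W. {f \<in> bijections (insert x V) W. f x = y})"
      by (auto simp: bijections_def)
    then have "card (bijections (insert x V) W) = (\<Sum>y\<in>W. card {f \<in> bijections (insert x V) W. f x = y})"
      by (subst card_UN_disjoint[symmetric]) (use insert in auto)
    also have "\<dots> = (\<Sum>y\<in>W. fact (card V))"
    proof (rule sum.cong)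
      fix y assume y: "y \<in> W"
      have "card {f \<in> bijections (insert x V) W. f x = y} = card (bijections V (W - {y}))"
        using bij_betw_same_card[OF bij_betw_bijections_remove[of x "insert x V" y W]] y insert(2) by simp
      also have "\<dots> = fact (card V)" using insert y fW by simp
      finally show "card {f \<in> bijections (insert x V) W. f x = y} = fact (card V)" .
    qed simp
    finally show ?case using insert fW by simp
  qed
  then show ?case by simp
next
  case (Cons c cs)
  obtain A X where c: "c = (A, X)" by (cases c)
  have "finite A" using Cons c by (auto intro: finite_subset)
  then show ?case using Cons(2-5) unfolding c
  proof (induction A arbitrary: V W X rule: finite_induct)
    case empty
    then have "separated cs V W" by (auto elim: separated_mono)
    from Cons.IH[OF empty(1-3) this] show ?case by simp
  next
    case (insert x A)
    have x: "x \<in> V" "x \<notin> A" and X: "X \<subseteq> W" using insert by auto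
    have "card {f \<in> bijections V W. obeys ((insert x A, X) # cs) f} =
      (\<Sum>y\<in>X. card {f \<in> bijections (V - {x}) (W - {y}). obeys ((A, X - {y}) # cs) f})"
      using insert by (intro card_bijections_insert_constraint) auto
    also have "\<dots> = (\<Sum>y\<in>X. falling (card X - 1) (card A) * (\<Prod>(A, X)\<leftarrow>cs. falling (card X) (card A)) *
       fact (card V - 1 - (card A + (\<Sum>(A, X)\<leftarrow>cs. card A))))"
    proof (rule sum.cong)
      fix y assume y: "y \<in> X"
      have "V - {x} - A = V - insert x A" "W - {y} - (X - {y}) = W - X" using y by auto
      then have "separated ((A, X - {y}) # cs) (V - {x}) (W - {y})"
        using insert.prems(4) x by auto
      moreover have "finite X" using X insert by (auto intro: finite_subset)
      ultimately show "card {f \<in> bijections (V - {x}) (W - {y}). obeys ((A, X - {y}) # cs) f} =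
        falling (card X - 1) (card A) * (\<Prod>(A, X)\<leftarrow>cs. falling (card X) (card A)) *
        fact (card V - 1 - (card A + (\<Sum>(A, X)\<leftarrow>cs. card A)))"
        using insert.IH[of "V - {x}" "W - {y}" "X - {y}"] insert.prems x y X
        by (auto simp: card_Diff_singleton)
    qed simp
    finally show ?case using insert(1,2) by (simp add: mult.assoc)
  qed
qed

section \<open>Greedy colouring\<close>

text \<open>The colour of u depends only on vertices with smaller \<open>f\<close>, so well-founded
  recursion along \<open>measure f\<close> applies. A vertex turns red exactly when blue would
  complete a blue edge.\<close>

lemma greedy_colouring:
  fixes f :: "'a \<Rightarrow> nat"
  obtains c where "\<And>u. c u = Red \<longleftrightarrow> (\<exists>A\<in>E. u \<in> A \<and> (\<forall>x\<in>A - {u}. f x < f u \<and> c x = Blue))"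
proof
  define F where "F = (\<lambda>c u. if \<exists>A\<in>E. u \<in> A \<and> (\<forall>x\<in>A - {u}. f x < f u \<and> c x = Blue) then Red else Blue)"
  define c where "c = wfrec (measure f) F"
  fix u
  have "c u = F (cut c (measure f) u) u"
    unfolding c_def by (rule wfrec) simp
  \<comment> \<open>Cutting \<open>c\<close> off at u changes nothing: \<open>F\<close> consults
    \<open>c x\<close> only under f x < f u, which the congruence rules keep available.\<close>
  also have "\<dots> = F c u"
    unfolding F_def by (intro if_cong bex_cong conj_cong ball_cong) (auto simp: cut_def)
  finally show "c u = Red \<longleftrightarrow> (\<exists>A\<in>E. u \<in> A \<and> (\<forall>x\<in>A - {u}. f x < f u \<and> c x = Blue))"
    by (simp add: F_def)
qed

locale uncolourable =
  fixes E :: "'a set set" and n :: nat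
  assumes finite_E: "finite E"
    and card_edge: "A \<in> E \<Longrightarrow> card A = n"
    and n_ge_2: "2 \<le> n"
    and not_property_B: "\<not> property_B E"
begin

lemma finite_edge: "A \<in> E \<Longrightarrow> finite A"
  using card_edge n_ge_2 by (metis card.infinite not_numeral_le_zero)

lemma finite_Union_edges: "finite (\<Union>E)"
  using finite_E finite_edge by auto

text \<open>A monochromatic edge B of the greedy colouring is not blue, since its last vertex would
  have turned red. So B is red, and its first vertex u is red because some edge A ends at u. The
  position of u decides the case: before L all of A is early, from S on all of B is late, and in
  between A and B form a chain at u.\<close>

lemma ordered_chain:
  fixes f :: "'a \<Rightarrow> nat"
  assumes inj: "inj_on f (\<Union>E)"
  obtains (first) A where "A \<in> E" "\<And>x. x \<in> A \<Longrightarrow> f x < L"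
  | (last) B where "B \<in> E" "\<And>x. x \<in> B \<Longrightarrow> S \<le> f x"
  | (chain) A B u where "A \<in> E" "B \<in> E" "A \<inter> B = {u}" "L \<le> f u" "f u < S"
      "\<And>x. x \<in> A - {u} \<Longrightarrow> f x < f u" "\<And>x. x \<in> B - {u} \<Longrightarrow> f u < f x"
proof -
  obtain c where c: "\<And>u. c u = Red \<longleftrightarrow> (\<exists>A\<in>E. u \<in> A \<and> (\<forall>x\<in>A - {u}. f x < f u \<and> c x = Blue))"
    using greedy_colouring[where E = E and f = f] by blast
  obtain B where B: "B \<in> E" "monochromatic c B"
    using not_property_B by (auto simp: property_B_def)
  have Bne: "B \<noteq> {}" "finite B" using finite_edge card_edge[OF B(1)] n_ge_2 B(1) by auto
  have ne: "f x \<noteq> f y" if "x \<in> B" "y \<in> B" "x \<noteq> y" for x y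
    using that inj B(1) by (auto simp: inj_on_def)
  obtain k where k: "\<And>x. x \<in> B \<Longrightarrow> c x = k" using B by (auto simp: monochromatic_def)
  have "k = Red"
  proof (rule ccontr)
    assume "k \<noteq> Red"
    then have blue: "c x = Blue" if "x \<in> B" for x using k[OF that] by (cases k) auto
    have "Max (f ` B) \<in> f ` B" using Bne by simp
    then obtain u where "u \<in> B" "Max (f ` B) = f u" by blast
    then have u: "u \<in> B" "\<And>x. x \<in> B \<Longrightarrow> f x \<le> f u" using Bne(2) by (auto dest: sym)
    have "f x < f u" if "x \<in> B - {u}" for x
      using u(2)[of x] ne[of x u] that u(1) by force
    then have "c u = Red" using c[of u] B(1) u(1) blue by blast
    with blue[OF u(1)] show False by simp
  qed
  have "Min (f ` B) \<in> f ` B" using Bne by simp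
  then obtain u where "u \<in> B" "Min (f ` B) = f u" by blast
  then have u: "u \<in> B" "\<And>x. x \<in> B \<Longrightarrow> f u \<le> f x" using Bne(2) by (auto dest: sym)
  have up: "f u < f x" if "x \<in> B - {u}" for x
    using u(2)[of x] ne[of x u] that u(1) by force
  obtain A where A: "A \<in> E" "u \<in> A" "\<And>x. x \<in> A - {u} \<Longrightarrow> f x < f u"
    using c[of u] k[OF u(1)] \<open>k = Red\<close> by auto
  show ?thesis
  proof (cases "f u < L")
    case True
    then have "f x < L" if "x \<in> A" for x using A(3)[of x] that by force
    then show ?thesis using first A(1) by blast
  next
    case L: False
    show ?thesis
    proof (cases "f u < S")
      case True
      have "A \<inter> B = {u}" using A u up by force
      then show ?thesis using chain[of A B u] A B(1) up L True by auto
    next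
      case False
      then show ?thesis using last[of B] B(1) u(2) by force
    qed
  qed
qed

section \<open>Union bounds over vertex orders\<close>

definition chain_pairs :: "('a set \<times> 'a set) set" where
  "chain_pairs = {(A, B) \<in> E \<times> E. card (A \<inter> B) = 1}"

lemma finite_chain_pairs [simp]: "finite chain_pairs"
  unfolding chain_pairs_def by (rule finite_subset[of _ "E \<times> E"]) (use finite_E in auto)

lemma chain_pairs_neq: "(A, A) \<notin> chain_pairs"
  using n_ge_2 card_edge by (auto simp: chain_pairs_def)

lemma card_edge_diff: "(A, B) \<in> chain_pairs \<Longrightarrow> card (A - B) = n - 1 \<and> card (B - A) = n - 1"
  using card_edge finite_edge by (auto simp: chain_pairs_def card_Diff_subset_Int Int_commute)

text \<open>Each of the v! orders is caught by \<open>ordered_chain\<close>. The three kinds of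
  configuration are counted with \<open>card_bijections\<close>, chains separately for each position
  j of the common vertex, and the factorial of v - (2n-1) is cancelled. V may contain isolated
  vertices.\<close>

lemma ordering_bound:
  assumes fin: "finite V" and EV: "\<Union>E \<subseteq> V" and v: "card V = v" "2 * n - 1 \<le> v" and LS: "L \<le> S" "S \<le> v"
  shows "falling v (2 * n - 1) \<le>
      card E * (falling L n + falling (v - S) n) * falling (v - n) (n - 1)
      + card chain_pairs * (\<Sum>j=L..<S. falling j (n - 1) * falling (v - 1 - j) (n - 1))"
proof -
  let ?F = "bijections V {..<v}"
  let ?cs = "\<lambda>j (A, B). [(A \<inter> B, {j}), (A - B, {..<j}), (B - A, {j<..<v})]"
  define X where "X = (\<lambda>A. {f \<in> ?F. obeys [(A, {..<L})] f})"
  define Y where "Y = (\<lambda>A. {f \<in> ?F. obeys [(A, {S..<v})] f})"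
  define Z where "Z = (\<lambda>p j. {f \<in> ?F. obeys (?cs j p) f})"
  have finF: "finite ?F" using fin by simp
  have cF: "card ?F = fact v"
    using card_bijections[of V "{..<v}" "[]"] fin v by simp
  have cX: "card (X A) = falling L n * fact (v - n)" if "A \<in> E" for A
    unfolding X_def using fin v that EV LS card_edge[OF that]
    by (subst card_bijections) auto
  have cY: "card (Y A) = falling (v - S) n * fact (v - n)" if "A \<in> E" for A
    unfolding Y_def using fin v that EV LS card_edge[OF that]
    by (subst card_bijections) auto
  have cZ: "card (Z p j) = falling j (n - 1) * falling (v - 1 - j) (n - 1) * fact (v - (2 * n - 1))"
    if p: "p \<in> chain_pairs" and j: "j \<in> {L..<S}" for p j
  proof -
    obtain A B where [simp]: "p = (A, B)" by (cases p)
    have AB: "card (A \<inter> B) = 1" "A \<subseteq> V" "B \<subseteq> V" using p EV by (auto simp: chain_pairs_def)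
    have "v - Suc (2 * n - 2) = v - (2 * n - 1)" using n_ge_2 by simp
    then show ?thesis
      unfolding Z_def using fin v AB LS j card_edge_diff[of A B] p
      by (subst card_bijections) (auto simp: mult_2[symmetric] algebra_simps)
  qed
  have "?F \<subseteq> (\<Union>A\<in>E. X A) \<union> (\<Union>A\<in>E. Y A) \<union> (\<Union>p\<in>chain_pairs. \<Union>j\<in>{L..<S}. Z p j)"
  proof
    fix f assume f: "f \<in> ?F"
    then have bij: "bij_betw f V {..<v}" by (auto simp: bijections_def)
    then have lt: "\<And>x. x \<in> V \<Longrightarrow> f x < v" by (auto dest: bij_betwE)
    have inj: "inj_on f (\<Union>E)" using bij EV by (auto simp: bij_betw_def intro: inj_on_subset)
    from inj show "f \<in> (\<Union>A\<in>E. X A) \<union> (\<Union>A\<in>E. Y A) \<union> (\<Union>p\<in>chain_pairs. \<Union>j\<in>{L..<S}. Z p j)"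
    proof (cases rule: ordered_chain[where L = L and S = S])
      case (first A)
      then have "f \<in> X A" using f by (auto simp: X_def)
      then show ?thesis using first(1) by blast
    next
      case (last B)
      then have "f \<in> Y B" using f lt EV by (auto simp: Y_def)
      then show ?thesis using last(1) by blast
    next
      case (chain A B u)
      have p: "(A, B) \<in> chain_pairs" using chain by (auto simp: chain_pairs_def)
      have "f u < f x \<and> f x < v" if "x \<in> B - A" for x
        using chain(7)[of x] lt[of x] chain(2,3) EV that by blast
      moreover have "f x < f u" if "x \<in> A - B" for x
        using chain(3) chain(6)[of x] that by blast
      ultimately have "f \<in> Z (A, B) (f u)"
        using chain(3) f by (auto simp: Z_def)
      then show ?thesis using p chain(4,5) by (auto intro!: bexI[of _ "(A, B)"] bexI[of _ "f u"])
    qed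
  qed
  then have "fact v \<le> card ((\<Union>A\<in>E. X A) \<union> (\<Union>A\<in>E. Y A) \<union> (\<Union>p\<in>chain_pairs. \<Union>j\<in>{L..<S}. Z p j))"
    unfolding cF[symmetric] by (rule card_mono[rotated]) (use finF finite_E in \<open>auto simp: X_def Y_def Z_def\<close>)
  also have "\<dots> \<le> card (\<Union>A\<in>E. X A) + card (\<Union>A\<in>E. Y A) + card (\<Union>p\<in>chain_pairs. \<Union>j\<in>{L..<S}. Z p j)"
    by (intro order_trans[OF card_Un_le] add_mono) auto
  also have "\<dots> \<le> (\<Sum>A\<in>E. card (X A)) + (\<Sum>A\<in>E. card (Y A)) + (\<Sum>p\<in>chain_pairs. \<Sum>j=L..<S. card (Z p j))"
    using finite_E by (intro add_mono card_UN_le order_trans[OF card_UN_le] sum_mono) auto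
  also have "\<dots> = fact (v - (2 * n - 1)) *
     (card E * (falling L n + falling (v - S) n) * falling (v - n) (n - 1)
      + card chain_pairs * (\<Sum>j=L..<S. falling j (n - 1) * falling (v - 1 - j) (n - 1)))"
  proof -
    \<comment> \<open>A single edge leaves v - n vertices free, a chain only v - (2n-1); the
      difference is the extra factor in the terms for single edges.\<close>
    have "v - n - (n - 1) = v - (2 * n - 1)" by simp
    then have "fact (v - n) = falling (v - n) (n - 1) * fact (v - (2 * n - 1))"
      using fact_eq_falling[of "n - 1" "v - n"] v by simp
    then show ?thesis
      by (simp add: cX cY cZ sum_distrib_left sum_distrib_right algebra_simps)
  qed
  finally show ?thesis
    using fact_eq_falling[OF v(2)] by (simp add: mult.commute)
qed

text \<open>The same union bound over the orders with u0 in position 0. An edge through u0 has only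
  n - 1 vertices left to place, so such edges occur early more often. For chains, the numbers of
  pairs are estimated by d e if u0 lies in A, and by e (e-1) if it lies in neither edge.\<close>

lemma ordering_bound_from_vertex:
  fixes u0 :: 'a
  defines "d \<equiv> card {A \<in> E. u0 \<in> A}" and "e \<equiv> card {A \<in> E. u0 \<notin> A}"
  assumes fin: "finite V" and EV: "\<Union>E \<subseteq> V" and u0: "u0 \<in> V"
    and v: "card V = v" "2 * n \<le> v" and LS: "1 \<le> L" "L \<le> S" "S \<le> v"
  shows "falling (v - 1) (2 * n - 1) \<le>
      d * falling (L - 1) (n - 1) * falling (v - n) n
      + e * (falling (L - 1) n + falling (v - S) n) * falling (v - 1 - n) (n - 1)
      + d * e * (v - 2 * n + 1) * (\<Sum>j=L..<S. falling (j - 1) (n - 2) * falling (v - 1 - j) (n - 1))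
      + e * (e - 1) * (\<Sum>j=L..<S. falling (j - 1) (n - 1) * falling (v - 1 - j) (n - 1))"
proof -
  let ?F = "bijections (V - {u0}) {1..<v}"
  let ?cs = "\<lambda>j (A, B). [(A \<inter> B, {j}), (A - B - {u0}, {1..<j}), (B - A, {j<..<v})]"
  define D where "D = {A \<in> E. u0 \<in> A}"
  define N where "N = {A \<in> E. u0 \<notin> A}"
  define P where "P = {(A, B) \<in> D \<times> N. card (A \<inter> B) = 1}"
  define Q where "Q = {(A, B) \<in> N \<times> N. card (A \<inter> B) = 1}"
  define X where "X = (\<lambda>A. {f \<in> ?F. obeys [(A - {u0}, {1..<L})] f})"
  define Y where "Y = (\<lambda>A. {f \<in> ?F. obeys [(A, {S..<v})] f})"
  define Z where "Z = (\<lambda>p j. {f \<in> ?F. obeys (?cs j p) f})"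
  have fins: "finite D" "finite N" using finite_E by (auto simp: D_def N_def)
  then have finPQ: "finite P" "finite Q"
    by (auto simp: P_def Q_def intro: finite_subset[of _ "D \<times> N"] finite_subset[of _ "N \<times> N"])
  have dd: "card D = d" "card N = e" by (auto simp: D_def N_def d_def e_def)
  have cV: "card (V - {u0}) = v - 1" using u0 v by simp
  have finF: "finite ?F" using fin by simp
  have cF: "card ?F = fact (v - 1)"
    using card_bijections[of "V - {u0}" "{1..<v}" "[]"] fin v cV by simp
  have cXD: "card (X A) = falling (L - 1) (n - 1) * fact (v - n)" if "A \<in> D" for A
  proof -
    have "card (A - {u0}) = n - 1" "v - 1 - (n - 1) = v - n" "A \<subseteq> V"
      using that card_edge EV n_ge_2 by (auto simp: D_def)
    then show ?thesis
      unfolding X_def using fin cV LS by (subst card_bijections) auto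
  qed
  have cXN: "card (X A) = falling (L - 1) n * fact (v - 1 - n)" if "A \<in> N" for A
  proof -
    have "card (A - {u0}) = n" "A \<subseteq> V"
      using that card_edge EV by (auto simp: N_def)
    then show ?thesis
      unfolding X_def using fin cV LS by (subst card_bijections) auto
  qed
  have cY: "card (Y A) = falling (v - S) n * fact (v - 1 - n)" if "A \<in> N" for A
  proof -
    have "card A = n" "A \<subseteq> V - {u0}"
      using that card_edge EV by (auto simp: N_def)
    then show ?thesis
      unfolding Y_def using fin cV LS by (subst card_bijections) auto
  qed
  have cZP: "card (Z p j) = (v - 2 * n + 1) * (falling (j - 1) (n - 2) * falling (v - 1 - j) (n - 1)) * fact (v - 2 * n)"
    if p: "p \<in> P" and j: "j \<in> {L..<S}" for p j
  proof -
    obtain A B where [simp]: "p = (A, B)" by (cases p)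
    have AB: "card (A \<inter> B) = 1" "A \<subseteq> V" "B \<subseteq> V - {u0}" "u0 \<in> A" "u0 \<notin> B" and AB': "(A, B) \<in> chain_pairs"
      using p EV by (auto simp: P_def D_def N_def chain_pairs_def)
    have "card (A - B - {u0}) = n - 2"
      using card_edge_diff[OF AB'] AB by simp
    then have "card (Z p j) = falling (j - 1) (n - 2) * falling (v - 1 - j) (n - 1) * fact (v - 1 - (1 + (n - 2 + (n - 1))))"
      unfolding Z_def using fin cV AB LS j card_edge_diff[OF AB']
      by (subst card_bijections) (auto simp: ac_simps)
    \<comment> \<open>A and B have 2n - 2 vertices besides u0, so v - 2n + 1 vertices stay free, one
      more than for pairs avoiding u0. This is the origin of the factor v - 2n + 1.\<close>
    also have "v - 1 - (1 + (n - 2 + (n - 1))) = Suc (v - 2 * n)" using v n_ge_2 by simp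
    finally show ?thesis by (simp add: algebra_simps)
  qed
  have cZQ: "card (Z p j) = falling (j - 1) (n - 1) * falling (v - 1 - j) (n - 1) * fact (v - 2 * n)"
    if p: "p \<in> Q" and j: "j \<in> {L..<S}" for p j
  proof -
    obtain A B where [simp]: "p = (A, B)" by (cases p)
    have AB: "card (A \<inter> B) = 1" "A \<subseteq> V - {u0}" "B \<subseteq> V - {u0}" "u0 \<notin> A" "u0 \<notin> B" and AB': "(A, B) \<in> chain_pairs"
      using p EV by (auto simp: Q_def N_def chain_pairs_def)
    have "card (A - B - {u0}) = n - 1"
      using card_edge_diff[OF AB'] AB by simp
    moreover have "v - 1 - (1 + (n - 1 + (n - 1))) = v - 2 * n" using v n_ge_2 by simp
    ultimately show ?thesis
      unfolding Z_def using fin cV AB LS j card_edge_diff[OF AB']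
      by (subst card_bijections) (auto simp: algebra_simps)
  qed
  have "?F \<subseteq> (\<Union>A\<in>D. X A) \<union> (\<Union>A\<in>N. X A) \<union> (\<Union>A\<in>N. Y A)
    \<union> (\<Union>p\<in>P. \<Union>j\<in>{L..<S}. Z p j) \<union> (\<Union>p\<in>Q. \<Union>j\<in>{L..<S}. Z p j)" (is "_ \<subseteq> ?U")
  proof
    fix g assume g: "g \<in> ?F"
    then have bij: "bij_betw g (V - {u0}) {1..<v}" by (auto simp: bijections_def)
    define f where "f = g(u0 := 0)"
    have fg: "f x = g x" if "x \<noteq> u0" for x using that by (simp add: f_def)
    have f0: "f u0 = 0" by (simp add: f_def)
    have rg: "g x < v" "1 \<le> g x" if "x \<in> V" "x \<noteq> u0" for x
      using that bij_betwE[OF bij] by auto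
    have "inj_on f V"
    proof (rule inj_onI)
      fix x y assume "x \<in> V" "y \<in> V" "f x = f y"
      then show "x = y"
        using bij_betw_imp_inj_on[OF bij] rg[of x] rg[of y]
        by (cases "x = u0"; cases "y = u0") (auto simp: f_def dest: inj_onD)
    qed
    then have "inj_on f (\<Union>E)" using EV by (rule inj_on_subset)
    then show "g \<in> ?U"
    proof (cases rule: ordered_chain[where L = L and S = S])
      case (first A)
      have "g ` (A - {u0}) \<subseteq> {1..<L}"
      proof (rule image_subsetI)
        fix x assume "x \<in> A - {u0}"
        then show "g x \<in> {1..<L}" using first EV rg[of x] fg[of x] by fastforce
      qed
      then have "g \<in> X A" using g by (simp add: X_def)
      moreover have "A \<in> D \<or> A \<in> N" using first(1) by (simp add: D_def N_def)
      ultimately show ?thesis by blast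
    next
      case (last B)
      have u0B: "u0 \<notin> B" using last(2)[of u0] f0 LS by auto
      have "g ` B \<subseteq> {S..<v}"
      proof (rule image_subsetI)
        fix x assume "x \<in> B"
        then show "g x \<in> {S..<v}" using last EV rg[of x] fg[of x] u0B by fastforce
      qed
      then have "g \<in> Y B" using g by (simp add: Y_def)
      moreover have "B \<in> N" using last(1) u0B by (simp add: N_def)
      ultimately show ?thesis by blast
    next
      case (chain A B u)
      \<comment> \<open>The common vertex has position at least L, hence at least 1, and the rest of
        B comes later; so u0 can lie only in A, and not as the common vertex.\<close>
      have u: "u \<noteq> u0" using chain(4) f0 LS by auto
      then have uB: "u0 \<notin> B" using chain(7)[of u0] f0 by auto
      have fu: "f u = g u" using fg u by simp
      have "g ` (A - B - {u0}) \<subseteq> {1..<g u}"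
      proof (rule image_subsetI)
        fix x assume "x \<in> A - B - {u0}"
        then have "x \<in> A - {u}" "x \<in> V" "x \<noteq> u0" using chain EV by auto
        then show "g x \<in> {1..<g u}" using chain(6)[of x] rg[of x] fg[of x] fu by auto
      qed
      moreover have "g ` (B - A) \<subseteq> {g u<..<v}"
      proof (rule image_subsetI)
        fix x assume "x \<in> B - A"
        then have "x \<in> B - {u}" "x \<in> V" "x \<noteq> u0" using chain EV uB by auto
        then show "g x \<in> {g u<..<v}" using chain(7)[of x] rg[of x] fg[of x] fu by auto
      qed
      ultimately have "g \<in> Z (A, B) (g u)" using g chain(3) by (simp add: Z_def)
      moreover have "g u \<in> {L..<S}" using chain(4,5) fu by simp
      moreover have "(A, B) \<in> P \<or> (A, B) \<in> Q"
        using chain(1,2,3) uB by (simp add: P_def Q_def D_def N_def)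
      ultimately show ?thesis by blast
    qed
  qed
  then have "fact (v - 1) \<le> card ?U"
    unfolding cF[symmetric] by (rule card_mono[rotated]) (use finF fins finPQ in \<open>auto simp: X_def Y_def Z_def\<close>)
  also have "\<dots> \<le> card (\<Union>A\<in>D. X A) + card (\<Union>A\<in>N. X A) + card (\<Union>A\<in>N. Y A)
    + card (\<Union>p\<in>P. \<Union>j\<in>{L..<S}. Z p j) + card (\<Union>p\<in>Q. \<Union>j\<in>{L..<S}. Z p j)"
    by (intro order_trans[OF card_Un_le] add_mono) auto
  also have "\<dots> \<le> (\<Sum>A\<in>D. card (X A)) + (\<Sum>A\<in>N. card (X A)) + (\<Sum>A\<in>N. card (Y A))
    + (\<Sum>p\<in>P. \<Sum>j=L..<S. card (Z p j)) + (\<Sum>p\<in>Q. \<Sum>j=L..<S. card (Z p j))"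
    using fins finPQ by (intro add_mono card_UN_le order_trans[OF card_UN_le] sum_mono) auto
  also have "\<dots> = fact (v - 2 * n) *
     (d * falling (L - 1) (n - 1) * falling (v - n) n
      + e * (falling (L - 1) n + falling (v - S) n) * falling (v - 1 - n) (n - 1)
      + card P * (v - 2 * n + 1) * (\<Sum>j=L..<S. falling (j - 1) (n - 2) * falling (v - 1 - j) (n - 1))
      + card Q * (\<Sum>j=L..<S. falling (j - 1) (n - 1) * falling (v - 1 - j) (n - 1)))"
  proof -
    have "v - 1 - n - (n - 1) = v - 2 * n" using n_ge_2 by simp
    then have "fact (v - 1 - n) = falling (v - 1 - n) (n - 1) * fact (v - 2 * n)"
      using fact_eq_falling[of "n - 1" "v - 1 - n"] v by simp
    moreover have "fact (v - n) = falling (v - n) n * fact (v - 2 * n)"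
      using fact_eq_falling[of n "v - n"] v by (simp add: mult_2)
    moreover have "(\<Sum>p\<in>P. \<Sum>j=L..<S. card (Z p j)) = card P * (v - 2 * n + 1) *
        (\<Sum>j=L..<S. falling (j - 1) (n - 2) * falling (v - 1 - j) (n - 1)) * fact (v - 2 * n)"
      by (simp only: cZP cong: sum.cong)
        (simp only: sum_constant of_nat_id sum_distrib_left sum_distrib_right mult_ac)
    moreover have "(\<Sum>p\<in>Q. \<Sum>j=L..<S. card (Z p j)) = card Q *
        (\<Sum>j=L..<S. falling (j - 1) (n - 1) * falling (v - 1 - j) (n - 1)) * fact (v - 2 * n)"
      by (simp only: cZQ cong: sum.cong)
        (simp only: sum_constant of_nat_id sum_distrib_left sum_distrib_right mult_ac)
    moreover have "(\<Sum>A\<in>D. card (X A)) = d * falling (L - 1) (n - 1) * fact (v - n)"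
      by (simp add: cXD dd)
    moreover have "(\<Sum>A\<in>N. card (X A)) = e * falling (L - 1) n * fact (v - 1 - n)"
      by (simp add: cXN dd)
    moreover have "(\<Sum>A\<in>N. card (Y A)) = e * falling (v - S) n * fact (v - 1 - n)"
      by (simp add: cY dd)
    ultimately show ?thesis by (simp only: distrib_left distrib_right mult_ac add_ac)
  qed
  also have "\<dots> \<le> fact (v - 2 * n) *
     (d * falling (L - 1) (n - 1) * falling (v - n) n
      + e * (falling (L - 1) n + falling (v - S) n) * falling (v - 1 - n) (n - 1)
      + (d * e) * (v - 2 * n + 1) * (\<Sum>j=L..<S. falling (j - 1) (n - 2) * falling (v - 1 - j) (n - 1))
      + (e * (e - 1)) * (\<Sum>j=L..<S. falling (j - 1) (n - 1) * falling (v - 1 - j) (n - 1)))"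
  proof (intro mult_left_mono mult_right_mono add_mono order_refl)
    have "card P \<le> card (D \<times> N)" using fins by (intro card_mono) (auto simp: P_def)
    then show "card P \<le> d * e" by (simp add: card_cartesian_product dd)
    \<comment> \<open>An edge meets itself in n \<ge> 2 vertices, so the diagonal can be
      discarded.\<close>
    have "Q \<subseteq> N \<times> N - (\<lambda>A. (A, A)) ` N"
      using n_ge_2 card_edge by (auto simp: Q_def N_def)
    then have "card Q \<le> card (N \<times> N - (\<lambda>A. (A, A)) ` N)" using fins by (intro card_mono) auto
    also have "\<dots> = e * e - e"
      using fins by (subst card_Diff_subset) (auto simp: card_cartesian_product dd card_image inj_on_def)
    finally show "card Q \<le> e * (e - 1)" by (simp add: diff_mult_distrib2)
  qed auto
  finally have "fact (v - 2 * n) * falling (v - 1) (2 * n - 1) \<le> \<dots>"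
    using fact_eq_falling[of "2 * n - 1" "v - 1"] v n_ge_2 by (simp add: mult.commute)
  then show ?thesis by simp
qed

end

section \<open>Degrees and pairs of edges with one common vertex\<close>

lemma sum_card_swap:
  assumes "finite S" "finite T"
  shows "(\<Sum>s\<in>S. card {t \<in> T. R s t}) = (\<Sum>t\<in>T. card {s \<in> S. R s t})"
  using assms by (intro sum_multicount_gen) auto

lemma card_pairs_neq: "finite F \<Longrightarrow> card {(A, B) \<in> F \<times> F. A \<noteq> B} = card F * (card F - 1)"
proof -
  assume F: "finite F"
  have "{(A, B) \<in> F \<times> F. A \<noteq> B} = F \<times> F - (\<lambda>A. (A, A)) ` F" by auto
  then have "card {(A, B) \<in> F \<times> F. A \<noteq> B} = card (F \<times> F - (\<lambda>A. (A, A)) ` F)" by (rule arg_cong)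
  also have "\<dots> = card F * card F - card F"
    using F by (subst card_Diff_subset) (auto simp: card_cartesian_product card_image inj_on_def)
  finally show ?thesis by (simp only: diff_mult_distrib2 mult_1_right)
qed

context uncolourable begin

definition deg :: "'a \<Rightarrow> nat" where
  "deg u = card {A \<in> E. u \<in> A}"

definition single_pairs :: "'a \<Rightarrow> ('a set \<times> 'a set) set" where
  "single_pairs u = {(A, B) \<in> E \<times> E. A \<inter> B = {u}}"

definition multiple_pairs :: "'a \<Rightarrow> ('a set \<times> 'a set) set" where
  "multiple_pairs u = {(A, B) \<in> E \<times> E. A \<noteq> B \<and> u \<in> A \<inter> B \<and> A \<inter> B \<noteq> {u}}"

lemma finite_pairs [simp]: "finite (single_pairs u)" "finite (multiple_pairs u)"
  by (rule finite_subset[of _ "E \<times> E"]; use finite_E in \<open>auto simp: single_pairs_def multiple_pairs_def\<close>)+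

lemma sum_deg: "(\<Sum>u\<in>\<Union>E. deg u) = n * card E"
proof -
  have "(\<Sum>u\<in>\<Union>E. deg u) = (\<Sum>A\<in>E. card {u \<in> \<Union>E. u \<in> A})"
    unfolding deg_def using finite_E finite_Union_edges by (rule sum_card_swap[rotated])
  also have "\<dots> = (\<Sum>A\<in>E. n)"
  proof (rule sum.cong)
    fix A assume A: "A \<in> E"
    then have "{u \<in> \<Union>E. u \<in> A} = A" by auto
    then show "card {u \<in> \<Union>E. u \<in> A} = n" using card_edge A by simp
  qed simp
  finally show ?thesis by simp
qed

lemma card_chain_pairs_le_sum: "card chain_pairs \<le> (\<Sum>u\<in>\<Union>E. card (single_pairs u))"
proof -
  have "chain_pairs \<subseteq> (\<Union>u\<in>\<Union>E. single_pairs u)"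
    by (auto simp: chain_pairs_def single_pairs_def card_1_singleton_iff)
  then have "card chain_pairs \<le> card (\<Union>u\<in>\<Union>E. single_pairs u)"
    by (rule card_mono[rotated]) (rule finite_UN_I[OF finite_Union_edges finite_pairs(1)])
  also have "\<dots> \<le> (\<Sum>u\<in>\<Union>E. card (single_pairs u))"
    using finite_Union_edges by (rule card_UN_le)
  finally show ?thesis .
qed

lemma card_chain_pairs_le: "card chain_pairs \<le> card E * (card E - 1)"
proof -
  have "card chain_pairs \<le> card {(A, B) \<in> E \<times> E. A \<noteq> B}"
    using finite_E chain_pairs_neq
    by (intro card_mono) (auto simp: chain_pairs_def intro: finite_subset[of _ "E \<times> E"])
  then show ?thesis by (simp only: card_pairs_neq[OF finite_E])
qed

lemma card_single_multiple:
  "card (single_pairs u) + card (multiple_pairs u) = deg u * (deg u - 1)"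
proof -
  let ?F = "{A \<in> E. u \<in> A}"
  have "single_pairs u \<inter> multiple_pairs u = {}"
    by (auto simp: single_pairs_def multiple_pairs_def)
  moreover have "single_pairs u \<union> multiple_pairs u = {(A, B) \<in> ?F \<times> ?F. A \<noteq> B}"
  proof -
    have "A \<noteq> B" if "A \<inter> B = {u}" "A \<in> E" for A B
      using that n_ge_2 card_edge[of A] by auto
    then show ?thesis unfolding single_pairs_def multiple_pairs_def by blast
  qed
  ultimately have "card (single_pairs u) + card (multiple_pairs u) = card {(A, B) \<in> ?F \<times> ?F. A \<noteq> B}"
    using card_Un_disjoint[of "single_pairs u" "multiple_pairs u"] by simp
  moreover have "finite ?F" using finite_E by simp
  ultimately show ?thesis by (simp only: card_pairs_neq deg_def)
qed

text \<open>The pairs are ordered, and swapping the two distinct edges gives another one. This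
  parity gain is needed for n = 5 with 24 vertices.\<close>

lemma card_multiple_pairs_ge_2:
  assumes "multiple_pairs u \<noteq> {}"
  shows "2 \<le> card (multiple_pairs u)"
proof -
  obtain A B where AB: "(A, B) \<in> multiple_pairs u" using assms by auto
  then have "{(A, B), (B, A)} \<subseteq> multiple_pairs u" "A \<noteq> B" by (auto simp: multiple_pairs_def)
  then have "card {(A, B), (B, A)} \<le> card (multiple_pairs u)" by (intro card_mono) auto
  then show ?thesis using \<open>A \<noteq> B\<close> by simp
qed

end

section \<open>Degrees when any two vertices share an edge\<close>

locale covered = uncolourable +
  assumes cover: "x \<in> \<Union>E \<Longrightarrow> y \<in> \<Union>E \<Longrightarrow> \<exists>A\<in>E. x \<in> A \<and> y \<in> A"
begin

text \<open>The edges through u cover all other vertices, each of them n - 1.\<close>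

lemma deg_lower:
  assumes u: "u \<in> \<Union>E"
  shows "card (\<Union>E) - 1 \<le> (n - 1) * deg u"
proof -
  have "\<Union>E - {u} \<subseteq> (\<Union>A\<in>{A \<in> E. u \<in> A}. A - {u})"
  proof
    fix w assume w: "w \<in> \<Union>E - {u}"
    then obtain A where "A \<in> E" "u \<in> A" "w \<in> A" using cover[OF u, of w] by blast
    then show "w \<in> (\<Union>A\<in>{A \<in> E. u \<in> A}. A - {u})" using w by blast
  qed
  then have "card (\<Union>E - {u}) \<le> card (\<Union>A\<in>{A \<in> E. u \<in> A}. A - {u})"
    using finite_E finite_edge by (intro card_mono) auto
  also have "\<dots> \<le> (\<Sum>A\<in>{A \<in> E. u \<in> A}. card (A - {u}))"
    using finite_E by (intro card_UN_le) auto
  also have "\<dots> = (\<Sum>A\<in>{A \<in> E. u \<in> A}. n - 1)"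
    using card_edge by (intro sum.cong) auto
  finally show ?thesis using u by (simp add: deg_def mult.commute)
qed

text \<open>Let l w be the number of edges through both u and w. The sum of l w is (n-1)
  \<open>deg u\<close>, while the sum of l w (l w - 1) counts each pair of distinct edges through u
  once per further common vertex, hence at most n - 2 times. The two sums are compared by (l-1)(l-2)
  \<ge> 0.\<close>

lemma multiple_pairs_lower:
  assumes u: "u \<in> \<Union>E"
  shows "2 * (n - 1) * deg u \<le> (n - 2) * card (multiple_pairs u) + 2 * (card (\<Union>E) - 1)"
proof -
  let ?F = "{A \<in> E. u \<in> A}" and ?W = "\<Union>E - {u}"
  define l where "l = (\<lambda>w. card {A \<in> ?F. w \<in> A})"
  have fin: "finite ?F" "finite ?W" using finite_E finite_Union_edges by auto
  have sum_l: "(\<Sum>w\<in>?W. l w) = (n - 1) * deg u"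
  proof -
    have "(\<Sum>w\<in>?W. l w) = (\<Sum>A\<in>?F. card {w \<in> ?W. w \<in> A})"
      unfolding l_def using fin by (rule sum_card_swap[rotated])
    also have "\<dots> = (\<Sum>A\<in>?F. n - 1)"
    proof (rule sum.cong)
      fix A assume A: "A \<in> ?F"
      then have "{w \<in> ?W. w \<in> A} = A - {u}" by auto
      then show "card {w \<in> ?W. w \<in> A} = n - 1" using card_edge A by simp
    qed simp
    finally show ?thesis by (simp add: deg_def)
  qed
  have l_pos: "1 \<le> l w" if w: "w \<in> ?W" for w
  proof -
    obtain A where "A \<in> ?F" "w \<in> A" using cover[OF u, of w] w by auto
    then have "{A \<in> ?F. w \<in> A} \<noteq> {}" by blast
    moreover have "finite {A \<in> ?F. w \<in> A}" using finite_E by simp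
    ultimately have "0 < l w" unfolding l_def using card_gt_0_iff by blast
    then show ?thesis by simp
  qed
  have pairs: "card {p \<in> multiple_pairs u. w \<in> fst p \<inter> snd p} = l w * (l w - 1)" if w: "w \<in> ?W" for w
  proof -
    let ?G = "{A \<in> ?F. w \<in> A}"
    have "{p \<in> multiple_pairs u. w \<in> fst p \<inter> snd p} = {(A, B) \<in> ?G \<times> ?G. A \<noteq> B}"
      using w by (auto simp: multiple_pairs_def)
    moreover have "finite ?G" using finite_E by simp
    ultimately show ?thesis by (simp only: card_pairs_neq l_def)
  qed
  have "2 * l w \<le> l w * (l w - 1) + 2" if w: "w \<in> ?W" for w
  proof -
    obtain k where "l w = Suc k" using l_pos[OF w] by (cases "l w") auto
    then show ?thesis by (cases k) auto
  qed
  then have "(\<Sum>w\<in>?W. 2 * l w) \<le> (\<Sum>w\<in>?W. l w * (l w - 1) + 2)" by (rule sum_mono)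
  then have "2 * (n - 1) * deg u \<le> (\<Sum>w\<in>?W. l w * (l w - 1)) + 2 * (card (\<Union>E) - 1)"
    using u by (simp only: sum_distrib_left[symmetric] sum.distrib sum_l sum_constant)
      (simp add: mult.assoc)
  also have "(\<Sum>w\<in>?W. l w * (l w - 1)) = (\<Sum>p\<in>multiple_pairs u. card {w \<in> ?W. w \<in> fst p \<inter> snd p})"
    using sum_card_swap[of ?W "multiple_pairs u" "\<lambda>w p. w \<in> fst p \<inter> snd p"] fin pairs by simp
  also have "\<dots> \<le> (\<Sum>p\<in>multiple_pairs u. n - 2)"
  proof (rule sum_mono)
    fix p assume p: "p \<in> multiple_pairs u"
    obtain A B where [simp]: "p = (A, B)" by (cases p)
    have AB: "A \<in> E" "B \<in> E" "A \<noteq> B" "u \<in> A" "u \<in> B" using p by (auto simp: multiple_pairs_def)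
    \<comment> \<open>Distinct edges of equal size share at most n - 1 vertices, one of which is
      u.\<close>
    have "A \<inter> B \<noteq> A" using AB card_edge finite_edge card_subset_eq[of B A] by auto
    then have "A \<inter> B \<subset> A" by blast
    then have "card (A \<inter> B) < card A" by (rule psubset_card_mono[OF finite_edge[OF AB(1)]])
    then have "card (A \<inter> B) < n" using card_edge[OF AB(1)] by simp
    moreover have "card (A \<inter> B - {u}) = card (A \<inter> B) - 1" using AB by simp
    moreover have "{w \<in> ?W. w \<in> fst p \<inter> snd p} = A \<inter> B - {u}" using AB by auto
    ultimately show "card {w \<in> ?W. w \<in> fst p \<inter> snd p} \<le> n - 2" by simp
  qed
  finally show ?thesis by (simp add: mult.commute)
qed

lemma card_vertices_mult_le:
  assumes "\<And>u. u \<in> \<Union>E \<Longrightarrow> k \<le> deg u"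
  shows "card (\<Union>E) * k \<le> n * card E"
  using sum_mono[of "\<Union>E" "\<lambda>_. k" deg] assms by (simp add: sum_deg)

text \<open>A linear estimate at each vertex can be summed, because the total degree is n
  \<open>card E\<close>.\<close>

lemma card_chain_pairs_linear_bound:
  assumes "\<And>u. u \<in> \<Union>E \<Longrightarrow> c * card (single_pairs u) + a \<le> b * deg u"
  shows "c * card chain_pairs + a * card (\<Union>E) \<le> b * (n * card E)"
proof -
  have "c * card chain_pairs + a * card (\<Union>E) \<le> (\<Sum>u\<in>\<Union>E. c * card (single_pairs u) + a)"
    using card_chain_pairs_le_sum
    by (simp add: sum.distrib sum_distrib_left[symmetric] mult.commute[of a])
  also have "\<dots> \<le> (\<Sum>u\<in>\<Union>E. b * deg u)" using assms by (rule sum_mono)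
  also have "\<dots> = b * (n * card E)"
    by (simp add: sum_distrib_left[symmetric] sum_deg)
  finally show ?thesis .
qed

text \<open>Between k and D the convex function x (x-1) lies below its chord (k+D-1) x - k D.
  Subtract the pairs forced by \<open>multiple_pairs_lower\<close> and sum over the vertices;
  multiplying by n - 2 avoids fractions.\<close>

lemma card_chain_pairs_degree_bound:
  assumes deg: "\<And>u. u \<in> \<Union>E \<Longrightarrow> k \<le> deg u \<and> deg u \<le> D" and k: "1 \<le> k"
  shows "(n - 2) * card chain_pairs + ((n - 2) * (k * D)) * card (\<Union>E) + 2 * (n - 1) * (n * card E) \<le>
    (n - 2) * (k + D - 1) * (n * card E) + 2 * (card (\<Union>E) - 1) * card (\<Union>E)"
proof -
  let ?v = "card (\<Union>E)"
  have "(n - 2) * card (single_pairs u) + (n - 2) * (k * D) + 2 * (n - 1) * deg u \<le>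
      (n - 2) * (k + D - 1) * deg u + 2 * (?v - 1)" if u: "u \<in> \<Union>E" for u
  proof -
    obtain i j where ij: "deg u = k + i" "D = k + i + j"
      using deg[OF u] by (metis le_Suc_ex)
    obtain k' where k': "k = Suc k'" using k by (cases k) auto
    \<comment> \<open>The product i j = (deg u - k) (D - deg u) is the gap between chord and
      parabola.\<close>
    have "deg u * (deg u - 1) + k * D + i * j = (k + D - 1) * deg u"
      unfolding ij k' by (simp add: algebra_simps)
    then have "card (single_pairs u) + card (multiple_pairs u) + k * D \<le> (k + D - 1) * deg u"
      using card_single_multiple[of u] by linarith
    then have "(n - 2) * (card (single_pairs u) + card (multiple_pairs u) + k * D) \<le> (n - 2) * ((k + D - 1) * deg u)"
      by (rule mult_left_mono) simp
    then show ?thesis using multiple_pairs_lower[OF u] by (simp add: distrib_left mult.assoc)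
  qed
  then have "(\<Sum>u\<in>\<Union>E. (n - 2) * card (single_pairs u) + (n - 2) * (k * D) + 2 * (n - 1) * deg u) \<le>
      (\<Sum>u\<in>\<Union>E. (n - 2) * (k + D - 1) * deg u + 2 * (?v - 1))"
    by (rule sum_mono)
  then have "(n - 2) * (\<Sum>u\<in>\<Union>E. card (single_pairs u)) + ((n - 2) * (k * D)) * ?v + 2 * (n - 1) * (n * card E) \<le>
      (n - 2) * (k + D - 1) * (n * card E) + 2 * (?v - 1) * ?v"
    by (simp add: sum.distrib sum_distrib_left[symmetric] sum_deg mult.commute[of ?v])
  moreover have "(n - 2) * card chain_pairs \<le> (n - 2) * (\<Sum>u\<in>\<Union>E. card (single_pairs u))"
    using card_chain_pairs_le_sum by (rule mult_left_mono) simp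
  ultimately show ?thesis by linarith
qed

end

section \<open>The numerical bounds\<close>

lemma falling_numeral [simp]: "falling x (numeral k) = x * falling (x - 1) (pred_numeral k)"
  by (simp add: numeral_eq_Suc)

text \<open>Turns the sums of the checks into lists that the simplifier evaluates on
  numerals.\<close>

lemma sum_atLeastLessThan_eq_sum_list:
  fixes f :: "nat \<Rightarrow> nat"
  shows "sum f {a..<b} = sum_list (map f [a..<b])"
  by (simp add: interv_sum_list_conv_sum_set_nat)

text \<open>
  The cut-offs L and S and the constants N and d in the instances below come from a numerical
  search, which makes N as large and d as small as possible.
\<close>

definition chain_check :: "nat \<Rightarrow> nat \<Rightarrow> nat \<Rightarrow> nat \<Rightarrow> nat \<Rightarrow> nat \<Rightarrow> bool" where
  "chain_check n m v L S N \<longleftrightarrow> L \<le> S \<and> S \<le> v \<and> 2 * n - 1 \<le> v \<and>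
    m * (falling L n + falling (v - S) n) * falling (v - n) (n - 1)
      + N * (\<Sum>j=L..<S. falling j (n - 1) * falling (v - 1 - j) (n - 1)) < falling v (2 * n - 1)"

text \<open>
  The counting bound for orders starting at a vertex is quadratic and concave in the degree of that
  vertex. The second conjunct of the body expresses that it is decreasing from degree d on, so that
  only degree d has to be tested.
\<close>

definition degree_check :: "nat \<Rightarrow> nat \<Rightarrow> nat \<Rightarrow> nat \<Rightarrow> nat \<Rightarrow> nat \<Rightarrow> bool" where
  "degree_check n m v L S d \<longleftrightarrow> 1 \<le> L \<and> L \<le> S \<and> S \<le> v \<and> 2 * n \<le> v \<and> d \<le> m \<and>
    (let p = falling (L - 1) (n - 1) * falling (v - n) n;
         q = (falling (L - 1) n + falling (v - S) n) * falling (v - 1 - n) (n - 1);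
         r = (v - 2 * n + 1) * (\<Sum>j=L..<S. falling (j - 1) (n - 2) * falling (v - 1 - j) (n - 1));
         s = (\<Sum>j=L..<S. falling (j - 1) (n - 1) * falling (v - 1 - j) (n - 1));
         e = m - d
     in d * p + e * q + d * e * r + e * (e - 1) * s < falling (v - 1) (2 * n - 1)
        \<and> p + 2 * e * r + s \<le> q + m * r + 2 * e * s \<and> s \<le> r)"

text \<open>First e is raised to m - d, which only increases the left-hand side. The resulting
  quadratic in d is then compared with its value at d0: the difference factors, and
  \<open>slope\<close> with s \<le> r makes both factors nonnegative. Integers avoid truncated
  subtraction.\<close>

lemma quadratic_bound:
  fixes p q r s m d d0 e t :: int
  assumes t: "d0 * p + (m - d0) * q + d0 * (m - d0) * r + (m - d0) * ((m - d0) - 1) * s < t"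
    and slope: "p + 2 * (m - d0) * r + s \<le> q + m * r + 2 * (m - d0) * s" and sr: "s \<le> r"
    and nonneg: "0 \<le> q" "0 \<le> r" "0 \<le> s" "0 \<le> d" "0 \<le> e" and e: "d + e \<le> m" and d: "d0 \<le> d"
  shows "d * p + e * q + d * e * r + e * (e - 1) * s < t"
proof -
  define x where "x = m - d"
  define k where "k = m - d0"
  have x: "e \<le> x" "x \<le> k" "0 \<le> x" using e d nonneg by (auto simp: x_def k_def)
  \<comment> \<open>At e = 0 the factor e - 1 is negative, so monotonicity of products covers only e
    > 0.\<close>
  have "e * (e - 1) \<le> x * (x - 1)"
  proof (cases "e = 0")
    case True
    then show ?thesis using x by (cases "x = 0") auto
  qed (use x nonneg in \<open>auto intro: mult_mono\<close>)
  then have "e * (e - 1) * s \<le> x * (x - 1) * s" using nonneg by (intro mult_right_mono)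
  moreover have "e * q \<le> x * q" using x nonneg by (intro mult_right_mono)
  moreover have "d * e * r \<le> d * x * r" using x nonneg by (intro mult_right_mono mult_left_mono)
  moreover have "0 \<le> (k - x) * (q - p + m * r - s - (r - s) * (k + x))"
  proof (rule mult_nonneg_nonneg)
    have "(r - s) * (k + x) \<le> (r - s) * (2 * k)" using x sr by (intro mult_left_mono) auto
    then show "0 \<le> q - p + m * r - s - (r - s) * (k + x)"
      using slope unfolding k_def[symmetric] by (simp add: algebra_simps)
  qed (use x in simp)
  moreover have "(k - x) * (q - p + m * r - s - (r - s) * (k + x)) =
      d0 * p + k * q + d0 * k * r + k * (k - 1) * s - (d * p + x * q + d * x * r + x * (x - 1) * s)"
    unfolding k_def x_def by algebra
  ultimately show ?thesis using t[folded k_def] by linarith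
qed

section \<open>Consequences of the checks\<close>

context uncolourable begin

lemma obtain_superset:
  assumes "infinite (UNIV :: 'a set)" and "card (\<Union>E) \<le> v"
  obtains V where "finite V" "\<Union>E \<subseteq> V" "card V = v"
proof -
  have "infinite (UNIV - \<Union>E)" using assms(1) finite_Union_edges by (rule Diff_infinite_finite[rotated])
  then obtain B where B: "finite B" "card B = v - card (\<Union>E)" "B \<subseteq> UNIV - \<Union>E"
    using infinite_arbitrarily_large by blast
  then have "\<Union>E \<inter> B = {}" by blast
  then have "card (\<Union>E \<union> B) = v"
    using B assms(2) finite_Union_edges by (subst card_Un_disjoint) auto
  then show thesis using that[of "\<Union>E \<union> B"] B finite_Union_edges by auto
qed

lemma card_chain_pairs_gt:
  assumes inf: "infinite (UNIV :: 'a set)" and v: "card (\<Union>E) \<le> v" and m: "card E \<le> m"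
    and check: "chain_check n m v L S N"
  shows "N < card chain_pairs"
proof (rule ccontr)
  assume N: "\<not> N < card chain_pairs"
  obtain V where V: "finite V" "\<Union>E \<subseteq> V" "card V = v" using obtain_superset[OF inf v] .
  have "falling v (2 * n - 1) \<le>
      card E * (falling L n + falling (v - S) n) * falling (v - n) (n - 1)
      + card chain_pairs * (\<Sum>j=L..<S. falling j (n - 1) * falling (v - 1 - j) (n - 1))"
    using check by (intro ordering_bound[OF V(1,2,3)]) (auto simp: chain_check_def)
  also have "\<dots> \<le> m * (falling L n + falling (v - S) n) * falling (v - n) (n - 1)
      + N * (\<Sum>j=L..<S. falling j (n - 1) * falling (v - 1 - j) (n - 1))"
    using m N by (intro add_mono mult_right_mono) auto
  finally show False using check by (simp add: chain_check_def)
qed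

text \<open>A larger degree would violate \<open>ordering_bound_from_vertex\<close>: the check makes
  that bound fail at d, and \<open>quadratic_bound\<close> carries the failure on to the actual
  degree.\<close>

lemma deg_less:
  assumes inf: "infinite (UNIV :: 'a set)" and v: "card (\<Union>E) \<le> v" and m: "card E \<le> m"
    and check: "degree_check n m v L S d" and u: "u \<in> \<Union>E"
  shows "deg u < d"
proof (rule ccontr)
  assume d: "\<not> deg u < d"
  obtain V where V: "finite V" "\<Union>E \<subseteq> V" "card V = v" using obtain_superset[OF inf v] .
  define e where "e = card {A \<in> E. u \<notin> A}"
  define p where "p = falling (L - 1) (n - 1) * falling (v - n) n"
  define q where "q = (falling (L - 1) n + falling (v - S) n) * falling (v - 1 - n) (n - 1)"
  define r where "r = (v - 2 * n + 1) * (\<Sum>j=L..<S. falling (j - 1) (n - 2) * falling (v - 1 - j) (n - 1))"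
  define s where "s = (\<Sum>j=L..<S. falling (j - 1) (n - 1) * falling (v - 1 - j) (n - 1))"
  define t where "t = falling (v - 1) (2 * n - 1)"
  have c: "1 \<le> L" "L \<le> S" "S \<le> v" "2 * n \<le> v" "d \<le> m"
    "d * p + (m - d) * q + d * (m - d) * r + (m - d) * (m - d - 1) * s < t"
    "p + 2 * (m - d) * r + s \<le> q + m * r + 2 * (m - d) * s" "s \<le> r"
    using check by (simp_all add: degree_check_def Let_def p_def q_def r_def s_def t_def)
  have "t \<le> deg u * p + e * q + deg u * e * r + e * (e - 1) * s"
    using ordering_bound_from_vertex[OF V(1,2) subsetD[OF V(2) u] V(3) c(4,1-3)]
    unfolding t_def deg_def e_def p_def q_def r_def s_def by (simp only: mult.assoc)
  moreover have "deg u + e = card E"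
  proof -
    have "{A \<in> E. u \<in> A} \<union> {A \<in> E. u \<notin> A} = E" by blast
    moreover have "{A \<in> E. u \<in> A} \<inter> {A \<in> E. u \<notin> A} = {}" by blast
    ultimately show ?thesis
      unfolding deg_def e_def using finite_E card_Un_disjoint[of "{A \<in> E. u \<in> A}" "{A \<in> E. u \<notin> A}"] by simp
  qed
  ultimately have t: "t \<le> deg u * p + e * q + deg u * e * r + e * (e - 1) * s" and de: "deg u + e = card E"
    by blast+
  \<comment> \<open>Truncation is harmless here, as both sides vanish at x = 0.\<close>
  have pred: "int (x * (x - 1) * s) = int x * (int x - 1) * int s" for x
    by (cases x) (simp_all add: algebra_simps)
  have k: "int m - int d = int (m - d)" using c(5) by simp
  have "int (d * p + (m - d) * q + d * (m - d) * r + (m - d) * (m - d - 1) * s) < int t"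
    using c(6) by (simp only: of_nat_less_iff)
  then have 1: "int d * int p + (int m - int d) * int q + int d * (int m - int d) * int r
      + (int m - int d) * (int m - int d - 1) * int s < int t"
    by (simp only: k of_nat_add pred) (simp only: of_nat_mult)
  have "int (p + 2 * (m - d) * r + s) \<le> int (q + m * r + 2 * (m - d) * s)"
    using c(7) by (simp only: of_nat_le_iff)
  then have 2: "int p + 2 * (int m - int d) * int r + int s \<le> int q + int m * int r + 2 * (int m - int d) * int s"
    by (simp only: k of_nat_add of_nat_mult of_nat_numeral)
  have "int (deg u) * int p + int e * int q + int (deg u) * int e * int r + int e * (int e - 1) * int s < int t"
    using quadratic_bound[OF 1 2, of "int (deg u)" "int e"] c(8) de m d by simp
  then have "int (deg u * p + e * q + deg u * e * r + e * (e - 1) * s) < int t"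
    by (simp only: of_nat_add pred) (simp only: of_nat_mult)
  with t show False by linarith
qed

end

context covered begin

lemma deg_ge:
  assumes "u \<in> \<Union>E" and "(n - 1) * (k - 1) < card (\<Union>E) - 1"
  shows "k \<le> deg u"
proof -
  have "(n - 1) * (k - 1) < (n - 1) * deg u" using deg_lower[OF assms(1)] assms(2) by linarith
  then have "k - 1 < deg u" by simp
  then show ?thesis by linarith
qed

text \<open>With more than v vertices every degree would be at least k, and the total degree would
  exceed n m.\<close>

lemma card_vertices_le:
  assumes "(n - 1) * (k - 1) < v" and "card E \<le> m" and "n * m < (v + 1) * k"
  shows "card (\<Union>E) \<le> v"
proof (rule ccontr)
  assume v: "\<not> card (\<Union>E) \<le> v"
  then have "card (\<Union>E) * k \<le> n * card E"
    using assms(1) by (intro card_vertices_mult_le deg_ge) auto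
  moreover have "(v + 1) * k \<le> card (\<Union>E) * k" using v by (intro mult_right_mono) auto
  moreover have "n * card E \<le> n * m" using assms(2) by simp
  ultimately show False using assms(3) by linarith
qed

text \<open>Already m (m-1), the number of all ordered pairs of distinct edges when there are m of
  them, is too few chain pairs.\<close>

lemma few_vertices_contradiction:
  assumes "infinite (UNIV :: 'a set)" "card (\<Union>E) \<le> v" "card E \<le> m"
    and "chain_check n m v L S (m * (m - 1))"
  shows False
proof -
  have "m * (m - 1) < card E * (card E - 1)"
    using card_chain_pairs_gt[OF assms] card_chain_pairs_le by linarith
  moreover have "card E * (card E - 1) \<le> m * (m - 1)" using assms(3) by (intro mult_mono) auto
  ultimately show False by linarith
qed

text \<open>One computation covers w to v vertices: both checks are made at v after adding isolated
  vertices, and the least degree k comes from w. The conditions \<open>mono\<close> make the net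
  coefficients of \<open>card E\<close> and of the vertex number nonnegative, so that m edges and w
  vertices are the worst case, which \<open>count\<close> excludes.\<close>

lemma many_vertices_contradiction:
  assumes inf: "infinite (UNIV :: 'a set)" and v: "w \<le> card (\<Union>E)" "card (\<Union>E) \<le> v" and m: "card E \<le> m"
    and chain: "chain_check n m v L S N" and degree: "degree_check n m v L' S' (Suc D)"
    and k: "1 \<le> k" "(n - 1) * (k - 1) < w - 1"
    and mono: "2 * (n - 1) \<le> (n - 2) * (k + D - 1)" "2 * (v - 1) \<le> (n - 2) * (k * D)"
    and count: "(n - 2) * (k + D - 1) * (n * m) + 2 * (v - 1) * w <
      (n - 2) * Suc N + (n - 2) * (k * D) * w + 2 * (n - 1) * (n * m)"
  shows False
proof -
  let ?w = "card (\<Union>E)"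
  have "k \<le> deg u \<and> deg u \<le> D" if u: "u \<in> \<Union>E" for u
    using deg_ge[OF u, of k] k(2) v(1) deg_less[OF inf v(2) m degree u] by auto
  from card_chain_pairs_degree_bound[OF this k(1)]
  have "(n - 2) * card chain_pairs + (n - 2) * (k * D) * ?w + 2 * (n - 1) * (n * card E) \<le>
    (n - 2) * (k + D - 1) * (n * card E) + 2 * (?w - 1) * ?w" by simp
  also have "\<dots> \<le> (n - 2) * (k + D - 1) * (n * card E) + 2 * (v - 1) * ?w"
    using v by (intro add_left_mono mult_right_mono) auto
  finally have 1: "(n - 2) * card chain_pairs + (n - 2) * (k * D) * ?w + 2 * (n - 1) * (n * card E) \<le>
    (n - 2) * (k + D - 1) * (n * card E) + 2 * (v - 1) * ?w" .
  obtain a where a: "(n - 2) * (k + D - 1) = 2 * (n - 1) + a" using mono(1) le_Suc_ex by blast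
  obtain b where b: "(n - 2) * (k * D) = 2 * (v - 1) + b" using mono(2) le_Suc_ex by blast
  have "(n - 2) * Suc N \<le> (n - 2) * card chain_pairs"
    using card_chain_pairs_gt[OF inf v(2) m chain] by (intro mult_left_mono) auto
  moreover have "a * (n * card E) \<le> a * (n * m)" using m by simp
  moreover have "b * w \<le> b * ?w" using v by simp
  ultimately show False using 1 count unfolding a b distrib_right by linarith
qed

end

section \<open>Reduction to hypergraphs with all pairs covered\<close>

text \<open>Minimise the number of vertices. If x and y were in no common edge, mapping y to x would
  preserve edge sizes, add no edges and lose a vertex; a proper colouring of the image would pull
  back.\<close>

lemma obtain_covered:
  fixes E :: "'a set set"
  assumes "uncolourable E n" "card E \<le> m"
  obtains E' :: "'a set set" where "covered E' n" "card E' \<le> m"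
proof -
  define P where "P = (\<lambda>E :: 'a set set. uncolourable E n \<and> card E \<le> m)"
  have "P E" using assms by (simp add: P_def)
  then obtain F where F: "P F" and least: "\<And>F'. P F' \<Longrightarrow> card (\<Union>F) \<le> card (\<Union>F')"
    using ex_has_least_nat[of P E "\<lambda>E. card (\<Union>E)"] by blast
  interpret uncolourable F n using F by (simp add: P_def)
  have "covered F n"
  proof
    fix x y assume x: "x \<in> \<Union>F" and y: "y \<in> \<Union>F"
    show "\<exists>A\<in>F. x \<in> A \<and> y \<in> A"
    proof (rule ccontr)
      assume none: "\<not> (\<exists>A\<in>F. x \<in> A \<and> y \<in> A)"
      then have xy: "x \<noteq> y" using x by auto
      define g where "g = (\<lambda>z. if z = y then x else z)"
      have inj: "inj_on g A" if "A \<in> F" for A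
        using none that by (auto simp: inj_on_def g_def)
      have "\<not> property_B ((`) g ` F)"
      proof
        assume "property_B ((`) g ` F)"
        then obtain c where "\<And>A. A \<in> F \<Longrightarrow> \<not> monochromatic c (g ` A)"
          by (auto simp: property_B_def)
        then have "\<And>A. A \<in> F \<Longrightarrow> \<not> monochromatic (c \<circ> g) A"
          by (auto simp: monochromatic_def)
        then show False using not_property_B by (auto simp: property_B_def)
      qed
      then have "uncolourable ((`) g ` F) n"
        using finite_E n_ge_2 card_edge inj by unfold_locales (auto simp: card_image)
      moreover have "card ((`) g ` F) \<le> m"
        using card_image_le[OF finite_E, of "(`) g"] F by (simp add: P_def)
      ultimately have "card (\<Union>F) \<le> card (\<Union>((`) g ` F))" by (intro least) (simp add: P_def)
      also have "\<Union>((`) g ` F) \<subseteq> \<Union>F - {y}" using x xy by (auto simp: g_def)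
      then have "card (\<Union>((`) g ` F)) \<le> card (\<Union>F - {y})"
        using finite_Union_edges by (intro card_mono) auto
      also have "\<dots> < card (\<Union>F)" using y finite_Union_edges by (intro card_Diff1_less)
      finally show False by simp
    qed
  qed
  then show thesis using that F by (simp add: P_def)
qed

lemma least_edges_gt:
  assumes n: "2 \<le> n" and no: "\<And>E :: nat set set. covered E n \<Longrightarrow> card E \<le> m \<Longrightarrow> False"
  shows "m < \<^bold>m n"
proof (rule ccontr)
  assume m: "\<not> m < \<^bold>m n"
  have "\<exists>k (V :: nat set) E. uniform_hypergraph n V E \<and> \<not> property_B E \<and> card E = k"
    using ex_not_property_B[of n] n by auto
  from LeastI_ex[OF this] obtain V E where E: "uniform_hypergraph n (V :: nat set) E" "\<not> property_B E" "card E = \<^bold>m n"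
    unfolding least_edges_def[symmetric] by auto
  have "uncolourable E n"
  proof
    show "finite E" using E(1) by (auto simp: uniform_hypergraph_def intro: finite_subset[of _ "Pow V"])
    show "card A = n" if "A \<in> E" for A using E(1) that by (auto simp: uniform_hypergraph_def)
  qed (use n E in auto)
  then obtain E' :: "nat set set" where "covered E' n" "card E' \<le> m"
    using obtain_covered[of E n m] E(3) m by auto
  then show False by (rule no)
qed

section \<open>The instances n = 5 to 9\<close>

lemmas check_simps = chain_check_def degree_check_def Let_def sum_atLeastLessThan_eq_sum_list

lemma not_covered_5:
  assumes "covered (E :: nat set set) 5" and m: "card E \<le> 31"
  shows False
proof -
  interpret covered E 5 by fact
  let ?v = "card (\<Union>E)"
  \<comment> \<open>With 26 or more vertices all degrees would be at least 7, but 26 * 7 > 5 *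
    31.\<close>
  have "?v \<le> 25" by (rule card_vertices_le[of 7, OF _ m]) simp_all
  then consider "?v \<le> 21"
    | "22 \<le> ?v" "?v \<le> 22"
    | "23 \<le> ?v" "?v \<le> 23"
    | "24 \<le> ?v" "?v \<le> 24"
    | "25 \<le> ?v" "?v \<le> 25"
    by linarith
  then show False
  proof cases
    case 1
    have "chain_check 5 31 21 10 11 (31 * (31 - 1))" by (simp add: check_simps)
    from few_vertices_contradiction[OF infinite_UNIV_nat 1 m this] show False .
  next
    case 2
    have c: "chain_check 5 31 22 10 12 919" by (simp add: check_simps)
    have d: "degree_check 5 31 22 10 12 (Suc 8)" by (simp add: check_simps)
    \<comment> \<open>The value 6 is the least degree: five edges through a vertex reach only 20 of
      the 21 others.\<close>
    show False by (rule many_vertices_contradiction[OF infinite_UNIV_nat 2 m c d, of 6]) simp_all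
  next
    case 3
    have c: "chain_check 5 31 23 10 13 870" by (simp add: check_simps)
    have d: "degree_check 5 31 23 10 12 (Suc 10)" by (simp add: check_simps)
    show False by (rule many_vertices_contradiction[OF infinite_UNIV_nat 3 m c d, of 6]) simp_all
  next
    case 4
    have c: "chain_check 5 31 24 10 14 830" by (simp add: check_simps)
    have d: "degree_check 5 31 24 10 13 (Suc 11)" by (simp add: check_simps)
    txt \<open>
      The general bound narrowly fails here. It is saved by a parity gain: a vertex of degree 6 lies
      in at least one ordered pair of edges with a further common vertex, hence in two of them. The
      line through (6, 28) and (11, 96) then bounds the number of pairs meeting only in u.
    \<close>
    have v: "?v = 24" using 4 by simp
    have "5 * card (single_pairs u) + 268 \<le> 68 * deg u" if u: "u \<in> \<Union>E" for u
    proof -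
      have lower: "6 \<le> deg u" using deg_ge[OF u, of 6] v by simp
      have "deg u < Suc 11" by (rule deg_less[OF infinite_UNIV_nat 4(2) m d u])
      with lower have deg: "deg u = 6 \<or> deg u = 7 \<or> deg u = 8 \<or> deg u = 9 \<or> deg u = 10 \<or> deg u = 11"
        by linarith
      have multiple: "8 * deg u \<le> 3 * card (multiple_pairs u) + 46"
        using multiple_pairs_lower[OF u] v by simp
      with lower have "multiple_pairs u \<noteq> {}" by auto
      then have "2 \<le> card (multiple_pairs u)" by (rule card_multiple_pairs_ge_2)
      with deg multiple show ?thesis
        using card_single_multiple[of u] by (elim disjE) simp_all
    qed
    \<comment> \<open>With at least 831 chain pairs, 5 * 831 + 268 * 24 = 10587 exceeds 68 * 5 * 31
      = 10540.\<close>
    from card_chain_pairs_linear_bound[OF this]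
    show False using card_chain_pairs_gt[OF infinite_UNIV_nat 4(2) m c] m v by simp
  next
    case 5
    have c: "chain_check 5 31 25 11 14 827" by (simp add: check_simps)
    have d: "degree_check 5 31 25 10 14 (Suc 12)" by (simp add: check_simps)
    show False by (rule many_vertices_contradiction[OF infinite_UNIV_nat 5 m c d, of 6]) simp_all
  qed
qed

text \<open>The range from 35 vertices uses degree at least 7; from 37 on it is at least 8, as 5 * 7
  < 36.\<close>

lemma not_covered_6:
  assumes "covered (E :: nat set set) 6" and m: "card E \<le> 63"
  shows False
proof -
  interpret covered E 6 by fact
  let ?v = "card (\<Union>E)"
  have "?v \<le> 42" by (rule card_vertices_le[of 9, OF _ m]) simp_all
  then consider "?v \<le> 34"
    | "35 \<le> ?v" "?v \<le> 36"
    | "37 \<le> ?v" "?v \<le> 37"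
    | "38 \<le> ?v" "?v \<le> 38"
    | "39 \<le> ?v" "?v \<le> 39"
    | "40 \<le> ?v" "?v \<le> 40"
    | "41 \<le> ?v" "?v \<le> 42"
    by linarith
  then show False
  proof cases
    case 1
    have "chain_check 6 63 34 15 19 (63 * (63 - 1))" by (simp add: check_simps)
    from few_vertices_contradiction[OF infinite_UNIV_nat 1 m this] show False .
  next
    case 2
    have c: "chain_check 6 63 36 16 20 3866" by (simp add: check_simps)
    have d: "degree_check 6 63 36 16 20 (Suc 14)" by (simp add: check_simps)
    show False by (rule many_vertices_contradiction[OF infinite_UNIV_nat 2 m c d, of 7]) simp_all
  next
    case 3
    have c: "chain_check 6 63 37 16 21 3802" by (simp add: check_simps)
    have d: "degree_check 6 63 37 16 21 (Suc 16)" by (simp add: check_simps)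
    show False by (rule many_vertices_contradiction[OF infinite_UNIV_nat 3 m c d, of 8]) simp_all
  next
    case 4
    have c: "chain_check 6 63 38 16 22 3720" by (simp add: check_simps)
    have d: "degree_check 6 63 38 16 21 (Suc 17)" by (simp add: check_simps)
    show False by (rule many_vertices_contradiction[OF infinite_UNIV_nat 4 m c d, of 8]) simp_all
  next
    case 5
    have c: "chain_check 6 63 39 17 22 3715" by (simp add: check_simps)
    have d: "degree_check 6 63 39 16 22 (Suc 19)" by (simp add: check_simps)
    show False by (rule many_vertices_contradiction[OF infinite_UNIV_nat 5 m c d, of 8]) simp_all
  next
    case 6
    have c: "chain_check 6 63 40 17 23 3675" by (simp add: check_simps)
    have d: "degree_check 6 63 40 17 22 (Suc 19)" by (simp add: check_simps)
    show False by (rule many_vertices_contradiction[OF infinite_UNIV_nat 6 m c d, of 8]) simp_all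
  next
    case 7
    have c: "chain_check 6 63 42 18 24 3612" by (simp add: check_simps)
    have d: "degree_check 6 63 42 17 24 (Suc 21)" by (simp add: check_simps)
    show False by (rule many_vertices_contradiction[OF infinite_UNIV_nat 7 m c d, of 8]) simp_all
  qed
qed

text \<open>A single pair of checks at 73 serves all counts from 64 on; the least degree 11 comes
  from the lower end, as 6 * 10 < 63.\<close>

lemma not_covered_7:
  assumes "covered (E :: nat set set) 7" and m: "card E \<le> 127"
  shows False
proof -
  interpret covered E 7 by fact
  let ?v = "card (\<Union>E)"
  have "?v \<le> 73" by (rule card_vertices_le[of 13, OF _ m]) simp_all
  then consider "?v \<le> 63"
    | "64 \<le> ?v" "?v \<le> 73"
    by linarith
  then show False
  proof cases
    case 1
    have "chain_check 7 127 63 27 36 (127 * (127 - 1))" by (simp add: check_simps)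
    from few_vertices_contradiction[OF infinite_UNIV_nat 1 m this] show False .
  next
    case 2
    have c: "chain_check 7 127 73 31 42 15452" by (simp add: check_simps)
    have d: "degree_check 7 127 73 29 42 (Suc 31)" by (simp add: check_simps)
    show False by (rule many_vertices_contradiction[OF infinite_UNIV_nat 2 m c d, of 11]) simp_all
  qed
qed

text \<open>The ranges separate at 100, where the guaranteed least degree rises from 14 to 15, as 7
  * 14 < 99.\<close>

lemma not_covered_8:
  assumes "covered (E :: nat set set) 8" and m: "card E \<le> 262"
  shows False
proof -
  interpret covered E 8 by fact
  let ?v = "card (\<Union>E)"
  have "?v \<le> 120" by (rule card_vertices_le[of 18, OF _ m]) simp_all
  then consider "?v \<le> 95"
    | "96 \<le> ?v" "?v \<le> 99"
    | "100 \<le> ?v" "?v \<le> 120"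
    by linarith
  then show False
  proof cases
    case 1
    have "chain_check 8 262 95 40 55 (262 * (262 - 1))" by (simp add: check_simps)
    from few_vertices_contradiction[OF infinite_UNIV_nat 1 m this] show False .
  next
    case 2
    have c: "chain_check 8 262 99 42 57 68001" by (simp add: check_simps)
    have d: "degree_check 8 262 99 41 57 (Suc 41)" by (simp add: check_simps)
    show False by (rule many_vertices_contradiction[OF infinite_UNIV_nat 2 m c d, of 14]) simp_all
  next
    case 3
    have c: "chain_check 8 262 120 50 70 66010" by (simp add: check_simps)
    have d: "degree_check 8 262 120 48 69 (Suc 62)" by (simp add: check_simps)
    show False by (rule many_vertices_contradiction[OF infinite_UNIV_nat 3 m c d, of 15]) simp_all
  qed
qed

lemma not_covered_9:
  assumes "covered (E :: nat set set) 9" and m: "card E \<le> 537"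
  shows False
proof -
  interpret covered E 9 by fact
  let ?v = "card (\<Union>E)"
  have "?v \<le> 193" by (rule card_vertices_le[of 25, OF _ m]) simp_all
  then consider "?v \<le> 156"
    | "157 \<le> ?v" "?v \<le> 193"
    by linarith
  then show False
  proof cases
    case 1
    have "chain_check 9 537 156 66 90 (537 * (537 - 1))" by (simp add: check_simps)
    from few_vertices_contradiction[OF infinite_UNIV_nat 1 m this] show False .
  next
    case 2
    have c: "chain_check 9 537 193 80 113 281509" by (simp add: check_simps)
    have d: "degree_check 9 537 193 78 111 (Suc 104)" by (simp add: check_simps)
    show False by (rule many_vertices_contradiction[OF infinite_UNIV_nat 2 m c d, of 20]) simp_all
  qed
qed

theorem theorem1:
  shows "\<^bold>m 5 \<ge> 32 \<and> \<^bold>m 6 \<ge> 64 \<and> \<^bold>m 7 \<ge> 128 \<and> \<^bold>m 8 \<ge> 263 \<and> \<^bold>m 9 \<ge> 538"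
proof -
  have "31 < \<^bold>m 5" using not_covered_5 by (rule least_edges_gt[rotated]) auto
  moreover have "63 < \<^bold>m 6" using not_covered_6 by (rule least_edges_gt[rotated]) auto
  moreover have "127 < \<^bold>m 7" using not_covered_7 by (rule least_edges_gt[rotated]) auto
  moreover have "262 < \<^bold>m 8" using not_covered_8 by (rule least_edges_gt[rotated]) auto
  moreover have "537 < \<^bold>m 9" using not_covered_9 by (rule least_edges_gt[rotated]) auto
  ultimately show ?thesis by simp
qed

end
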